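(* For $n\ge 4$ let $L_n:=\sum_{T\in\mathcal{T}(P_n^2)}|\mathcal{L}(T)|$ be the total number of leaves over all spanning trees of the square $P_n^2$ of the path on $n$ vertices. Then, as formal power series, $$\sum_{m=0}^{\infty} L_{m+4}\,t^m=\frac{-2(2t^3 - 15t^2 + 27t - 9)}{(t^2 - 3t + 1)^2}.$$
   Context: All graphs are finite and simple. $P_n$ is the path graph on $n$ vertices. For a graph $G$ and $k\ge1$, the $k$-th power $G^k$ has $V(G^k)=V(G)$, and $uv$ is an edge iff the distance between $u$ and $v$ in $G$ is at least $1$ and at most $k$. $\mathcal{T}(G)$ is the set of labeled spanning trees of $G$ (isomorphic trees with different labels are different). $\mathcal{L}(T)$ is the set of leaves (vertices of degree exactly $1$ in $T$) of $T$. The family is $\mathcal{P}_k=\{P_n^k : k<\operatorname{diam} P_n\}=\{P_n^k : n\ge k+2\}$, here with $k=2$; the sequence is indexed so that the constant term of the generating function corresponds to the smallest member $n=k+2$. *)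

theory Defs
  imports
    "HOL-Computational_Algebra.Formal_Power_Series"
    "HOL-Library.Extended_Nat"
begin

datatype 'a ugraph = Graph (verts: "'a set") (edges: "'a set set")

definition simple_graph :: "'a ugraph \<Rightarrow> bool" where
  "simple_graph G \<longleftrightarrow> finite (verts G) \<and> (\<forall>e\<in>edges G. e \<subseteq> verts G \<and> card e = 2)"

definition adjacent :: "'a ugraph \<Rightarrow> 'a \<Rightarrow> 'a \<Rightarrow> bool" where
  "adjacent G u v \<longleftrightarrow> {u, v} \<in> edges G"

text \<open>Walks and cycles are lists of vertices; a walk given by a list \<open>p\<close> has \<open>length p - 1\<close> edges.\<close>

definition walk :: "'a ugraph \<Rightarrow> 'a \<Rightarrow> 'a list \<Rightarrow> 'a \<Rightarrow> bool" where
  "walk G u p v \<longleftrightarrow>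
     p \<noteq> [] \<and> hd p = u \<and> last p = v \<and> set p \<subseteq> verts G \<and> successively (adjacent G) p"

text \<open>The distance is \<open>\<infinity>\<close> (the infimum of the empty set) if no walk joins the two vertices.\<close>

definition distance :: "'a ugraph \<Rightarrow> 'a \<Rightarrow> 'a \<Rightarrow> enat" where
  "distance G u v = (INF p\<in>{p. walk G u p v}. enat (length p - 1))"

definition graph_power :: "'a ugraph \<Rightarrow> nat \<Rightarrow> 'a ugraph" where
  "graph_power G k = Graph (verts G)
     {{u, v} |u v. u \<in> verts G \<and> v \<in> verts G \<and> 1 \<le> distance G u v \<and> distance G u v \<le> enat k}"

definition path_graph :: "nat \<Rightarrow> nat ugraph" where
  "path_graph n = Graph {..<n} {{i, Suc i} |i. Suc i < n}"

definition connected_graph :: "'a ugraph \<Rightarrow> bool" where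
  "connected_graph G \<longleftrightarrow> verts G \<noteq> {} \<and> (\<forall>u\<in>verts G. \<forall>v\<in>verts G. \<exists>p. walk G u p v)"

text \<open>The closing edge of a cycle joins the last and the first vertex of the list.\<close>

definition is_cycle :: "'a ugraph \<Rightarrow> 'a list \<Rightarrow> bool" where
  "is_cycle G c \<longleftrightarrow> 3 \<le> length c \<and> distinct c \<and> set c \<subseteq> verts G \<and>
     successively (adjacent G) c \<and> adjacent G (last c) (hd c)"

definition tree :: "'a ugraph \<Rightarrow> bool" where
  "tree G \<longleftrightarrow> simple_graph G \<and> connected_graph G \<and> (\<nexists>c. is_cycle G c)"

definition spanning_trees :: "'a ugraph \<Rightarrow> 'a ugraph set" where
  "spanning_trees G = {T. tree T \<and> verts T = verts G \<and> edges T \<subseteq> edges G}"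

definition vertex_degree :: "'a ugraph \<Rightarrow> 'a \<Rightarrow> nat" where
  "vertex_degree G v = card {e \<in> edges G. v \<in> e}"

definition leaves :: "'a ugraph \<Rightarrow> 'a set" where
  "leaves G = {v \<in> verts G. vertex_degree G v = 1}"

definition total_leaves :: "'a ugraph \<Rightarrow> nat" where
  "total_leaves G = (\<Sum>T\<in>spanning_trees G. card (leaves T))"

lemma simple_graph_path_graph: "simple_graph (path_graph n)"
  by (auto simp: simple_graph_def path_graph_def)

lemma distance_self:
  assumes "u \<in> verts G"
  shows "distance G u u = 0"
proof -
  have "walk G u [u] u"
    using assms by (simp add: walk_def)
  then have "distance G u u \<le> enat (length [u] - 1)"
    unfolding distance_def by (intro INF_lower) simp
  then show ?thesis
    by (simp add: zero_enat_def[symmetric])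
qed

lemma simple_graph_graph_power:
  assumes "simple_graph G"
  shows "simple_graph (graph_power G k)"
  using assms by (fastforce simp: simple_graph_def graph_power_def distance_self card_2_iff)

lemma finite_spanning_trees:
  assumes "simple_graph G"
  shows "finite (spanning_trees G)"
proof -
  have "edges G \<subseteq> Pow (verts G)" "finite (verts G)"
    using assms by (auto simp: simple_graph_def)
  then have "finite (edges G)"
    by (meson finite_Pow_iff finite_subset)
  moreover have "spanning_trees G \<subseteq> Graph (verts G) ` Pow (edges G)"
  proof
    fix T assume "T \<in> spanning_trees G"
    then show "T \<in> Graph (verts G) ` Pow (edges G)"
      by (cases T) (auto simp: spanning_trees_def)
  qed
  ultimately show ?thesis
    by (meson finite_Pow_iff finite_imageI finite_subset)
qed

end

theory Submission
  imports Defs "HOL-Number_Theory.Fib"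
begin

text \<open>
  Write \<open>G n\<close> for the square of the path on the vertices \<open>0, \<dots>, n - 1\<close>, a strip of triangles with the
  edges \<open>{i, i + 1}\<close> and \<open>{i, i + 2}\<close>. Exchanging the two summations in the total number of leaves gives
  the sum, over the vertices \<open>v\<close>, of the number of spanning trees that have \<open>v\<close> as a leaf. Such a tree
  is an arbitrary spanning tree of \<open>G n - v\<close> together with an arbitrary edge at \<open>v\<close>, so the number is
  \<open>deg v * \<tau> (G n - v)\<close>, where \<open>\<tau>\<close> counts spanning trees.

  Deleting \<open>v\<close> from the strip leaves a strip on \<open>v\<close> vertices and a strip on \<open>n - 1 - v\<close> vertices, and
  the only edge between them is the bridge \<open>{v - 1, v + 1}\<close>. Every spanning tree contains the bridge,
  hence \<open>\<tau> (G n - v) = t v * t (n - 1 - v)\<close>, where \<open>t k = \<tau> (G k)\<close>, and \<open>t 0 = 1\<close> covers the two end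
  vertices. All degrees are 4 except for 2, 3 at either end, so that
  \<open>L n = 4 * (\<Sum>v<n. t v * t (n - 1 - v)) - 4 * t (n - 1) - 2 * t (n - 2)\<close> for \<open>n \<ge> 4\<close>.

  The numbers \<open>t k\<close> come from adding the last vertex \<open>v\<close> of a strip, whose two neighbours \<open>a\<close>, \<open>b\<close> are
  joined by an edge. In a spanning tree of the longer strip, \<open>v\<close> is either a leaf (two choices of the edge) or has
  degree two, and in the latter case contracting one edge at \<open>v\<close> gives a spanning tree that contains
  \<open>{a, b}\<close>. Counting the trees that contain the last edge of the strip along with all trees gives
  two interleaved recurrences, those of the Fibonacci numbers with odd and even index. In terms of
  the generating function \<open>T\<close> of \<open>t\<close>, which is a cubic polynomial divided by \<open>1 - 3 * x + x^2\<close>, the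
  leaf series multiplied by \<open>x^3\<close> is \<open>4 * T^2 - 4 * T - 2 * x * T\<close> without its terms of degree
  at most two; the claim is then a polynomial identity.

  The tree surgeries above (gluing along a bridge, attaching a leaf, subdividing an edge) are
  awkward for a notion of tree that is given by walks and cycles. They become short set-theoretic
  arguments after trees are recognised as the minimally connected graphs, with connectedness
  expressed by cuts: every nonempty proper vertex set is left by some edge. An equivalence
  between the connectedness of two graphs before and after such a surgery, applied to all edge
  sets, automatically yields the equivalence for minimal connectedness.
\<close>

section \<open>Trees as minimally connected edge sets\<close>

definition cut_connected :: "'a set \<Rightarrow> 'a set set \<Rightarrow> bool" where
  "cut_connected V E \<longleftrightarrow> V \<noteq> {} \<and>
     (\<forall>S. S \<subseteq> V \<and> S \<noteq> {} \<and> S \<noteq> V \<longrightarrow> (\<exists>x\<in>S. \<exists>y\<in>V - S. {x, y} \<in> E))"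

definition min_connected :: "'a set \<Rightarrow> 'a set set \<Rightarrow> bool" where
  "min_connected V E \<longleftrightarrow> cut_connected V E \<and> (\<forall>e\<in>E. \<not> cut_connected V (E - {e}))"

definition spanning_edge_sets :: "'a set \<Rightarrow> 'a set set \<Rightarrow> 'a set set set" where
  "spanning_edge_sets V E = {F. F \<subseteq> E \<and> min_connected V F}"

lemma successively_crossing:
  assumes "successively R p" "p \<noteq> []" "P (hd p)" "\<not> P (last p)"
  shows "\<exists>x\<in>set p. \<exists>y\<in>set p. R x y \<and> P x \<and> \<not> P y"
  using assms
proof (induction p)
  case (Cons a p)
  show ?case
  proof (cases "p = [] \<or> \<not> P (hd p)")
    case True
    with Cons.prems show ?thesis
      by (cases p) auto
  next
    case False
    with Cons show ?thesis
      by (auto simp: successively_Cons)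
  qed
qed simp

lemma cut_connected_crossing:
  assumes "cut_connected V E" "S \<subseteq> V" "S \<noteq> {}" "a \<in> V" "a \<notin> S"
  obtains x y where "x \<in> S" "y \<in> V" "y \<notin> S" "{x, y} \<in> E"
proof -
  have "S \<noteq> V"
    using assms by blast
  with assms have "\<exists>x\<in>S. \<exists>y\<in>V - S. {x, y} \<in> E"
    unfolding cut_connected_def by simp
  with that show thesis by blast
qed

text \<open>
  Since a cut is the same as its complement, only the side that avoids a chosen root matters. The
  root is chosen below so that the new edges of a surgery cannot be the crossing edges, or so that
  they are easily seen to be.
\<close>

lemma cut_connected_rooted:
  assumes "a \<in> V"
  shows "cut_connected V E \<longleftrightarrow>
    (\<forall>S. S \<subseteq> V - {a} \<and> S \<noteq> {} \<longrightarrow> (\<exists>x\<in>S. \<exists>y\<in>V - S. {x, y} \<in> E))"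
    (is "_ \<longleftrightarrow> ?R")
proof
  assume "cut_connected V E"
  with assms show ?R
    unfolding cut_connected_def by blast
next
  assume R: ?R
  have "\<exists>x\<in>S. \<exists>y\<in>V - S. {x, y} \<in> E" if S: "S \<subseteq> V" "S \<noteq> {}" "S \<noteq> V" for S
  proof (cases "a \<in> S")
    case False
    with R S show ?thesis by blast
  next
    case True
    with S have "V - S \<subseteq> V - {a} \<and> V - S \<noteq> {}" by blast
    with R have "\<exists>x\<in>V - S. \<exists>y\<in>V - (V - S). {x, y} \<in> E"
      by simp
    then obtain x y where "x \<in> V - S" "y \<in> V - (V - S)" "{x, y} \<in> E"
      by auto
    then have "y \<in> S" "x \<in> V - S" "{y, x} \<in> E"
      by (auto simp: insert_commute)
    then show ?thesis by blast
  qed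
  with assms show "cut_connected V E"
    unfolding cut_connected_def by blast
qed

text \<open>
  The vertices reachable from \<open>u\<close> by walks without repetition form a set that no edge leaves: an
  edge to a vertex already visited leads to a shorter such walk. Repetition-free walks are needed
  because they are turned into cycles later.
\<close>

lemma cut_connected_imp_distinct_walk:
  assumes "cut_connected V E" "u \<in> V" "v \<in> V"
  shows "\<exists>p. distinct p \<and> walk (Graph V E) u p v"
proof -
  define R where "R = {w \<in> V. \<exists>p. distinct p \<and> walk (Graph V E) u p w}"
  have "walk (Graph V E) u [u] u"
    using assms by (simp add: walk_def)
  then have "u \<in> R"
    using assms unfolding R_def by (auto intro: exI[of _ "[u]"])
  have "R = V"
  proof (rule ccontr)
    assume "R \<noteq> V"
    moreover have "R \<subseteq> V" "R \<noteq> {}"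
      using \<open>u \<in> R\<close> by (auto simp: R_def)
    ultimately obtain x y where xy: "x \<in> R" "y \<in> V - R" "{x, y} \<in> E"
      using assms(1) unfolding cut_connected_def by blast
    then obtain p where p: "distinct p" "walk (Graph V E) u p x"
      by (auto simp: R_def)
    have "\<exists>q. distinct q \<and> walk (Graph V E) u q y"
    proof (cases "y \<in> set p")
      case True
      then obtain p1 p2 where "p = p1 @ y # p2"
        by (meson split_list)
      with p have "distinct (p1 @ [y]) \<and> walk (Graph V E) u (p1 @ [y]) y"
        by (cases p1) (auto simp: walk_def successively_append_iff successively_Cons hd_append)
      then show ?thesis by blast
    next
      case False
      with p xy have "distinct (p @ [y]) \<and> walk (Graph V E) u (p @ [y]) y"
        by (auto simp: walk_def successively_append_iff adjacent_def)
      then show ?thesis by blast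
    qed
    with xy show False by (auto simp: R_def)
  qed
  with assms show ?thesis by (auto simp: R_def)
qed

lemma connected_graph_iff_cut_connected:
  "connected_graph (Graph V E) \<longleftrightarrow> cut_connected V E"
proof
  assume con: "connected_graph (Graph V E)"
  have "\<exists>x\<in>S. \<exists>y\<in>V - S. {x, y} \<in> E" if S: "S \<subseteq> V" "S \<noteq> {}" "S \<noteq> V" for S
  proof -
    obtain u v where "u \<in> S" "v \<in> V - S"
      using S by blast
    then have "u \<in> V" "v \<in> V"
      using S by auto
    with con obtain p where p: "walk (Graph V E) u p v"
      unfolding connected_graph_def by auto
    then show ?thesis
      using successively_crossing[of "adjacent (Graph V E)" p "\<lambda>x. x \<in> S"] \<open>u \<in> S\<close> \<open>v \<in> V - S\<close>
      by (fastforce simp: walk_def adjacent_def)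
  qed
  with con show "cut_connected V E"
    by (auto simp: cut_connected_def connected_graph_def)
next
  assume "cut_connected V E"
  then show "connected_graph (Graph V E)"
    using cut_connected_imp_distinct_walk[of V E]
    by (fastforce simp: connected_graph_def cut_connected_def)
qed

text \<open>
  A cut that is crossed by the closing edge of the cycle is crossed a second time by the
  remaining path, whose edges all differ from the closing edge.
\<close>

lemma cut_connected_delete_cycle_edge:
  assumes "cut_connected V E" "is_cycle (Graph V E) c"
  shows "cut_connected V (E - {{last c, hd c}})"
proof -
  define e where "e = {last c, hd c}"
  have c: "3 \<le> length c" "distinct c" "set c \<subseteq> V" "successively (adjacent (Graph V E)) c"
    using assms(2) by (auto simp: is_cycle_def)
  then have "c \<noteq> []" by auto
  have path: "successively (\<lambda>x y. {x, y} \<in> E - {e}) c"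
    unfolding successively_conv_nth
  proof (intro allI impI)
    fix i assume i: "Suc i < length c"
    have "{c ! i, c ! Suc i} \<noteq> {c ! (length c - 1), c ! 0}"
    proof
      assume "{c ! i, c ! Suc i} = {c ! (length c - 1), c ! 0}"
      with c i \<open>c \<noteq> []\<close> have "{i, Suc i} = {length c - 1, 0}"
        by (auto simp: doubleton_eq_iff nth_eq_iff_index_eq)
      with c show False by (auto simp: doubleton_eq_iff)
    qed
    moreover have "{c ! i, c ! Suc i} \<in> E"
      using c(4) i by (auto simp: successively_conv_nth adjacent_def)
    ultimately show "{c ! i, c ! Suc i} \<in> E - {e}"
      using \<open>c \<noteq> []\<close> by (simp add: e_def last_conv_nth hd_conv_nth)
  qed
  have "\<exists>x\<in>S. \<exists>y\<in>V - S. {x, y} \<in> E - {e}" if S: "S \<subseteq> V" "S \<noteq> {}" "S \<noteq> V" for S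
  proof -
    obtain x y where xy: "x \<in> S" "y \<in> V - S" "{x, y} \<in> E"
      using assms(1) S unfolding cut_connected_def by blast
    show ?thesis
    proof (cases "{x, y} = e")
      case False
      with xy show ?thesis by blast
    next
      case True
      then consider "hd c \<in> S" "last c \<notin> S" | "hd c \<notin> S" "last c \<in> S"
        using xy by (auto simp: e_def doubleton_eq_iff)
      then show ?thesis
      proof cases
        case 1
        then show ?thesis
          using successively_crossing[OF path \<open>c \<noteq> []\<close>, of "\<lambda>x. x \<in> S"] c(3) by blast
      next
        case 2
        then obtain x y where "x \<in> set c" "y \<in> set c" "{x, y} \<in> E - {e}" "x \<notin> S" "y \<in> S"
          using successively_crossing[OF path \<open>c \<noteq> []\<close>, of "\<lambda>x. x \<notin> S"] by blast
        moreover from this have "x \<in> V - S" "{y, x} \<in> E - {e}"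
          using c(3) by (auto simp: insert_commute)
        ultimately show ?thesis by blast
      qed
    qed
  qed
  with assms(1) show ?thesis
    unfolding cut_connected_def e_def by blast
qed

text \<open>
  An edge whose deletion preserves connectedness closes a cycle with a repetition-free walk between
  its ends; conversely any edge of a cycle can be deleted.
\<close>

lemma tree_iff_min_connected:
  assumes "simple_graph (Graph V E)"
  shows "tree (Graph V E) \<longleftrightarrow> min_connected V E"
proof
  assume T: "tree (Graph V E)"
  then have con: "cut_connected V E" and acyc: "\<nexists>c. is_cycle (Graph V E) c"
    by (auto simp: tree_def connected_graph_iff_cut_connected)
  have "\<not> cut_connected V (E - {e})" if "e \<in> E" for e
  proof
    assume con': "cut_connected V (E - {e})"
    obtain a b where e: "e = {a, b}" "a \<noteq> b" "a \<in> V" "b \<in> V"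
      using assms \<open>e \<in> E\<close> by (fastforce simp: simple_graph_def card_2_iff)
    obtain p where p: "distinct p" "walk (Graph V (E - {e})) a p b"
      using cut_connected_imp_distinct_walk[OF con' e(3,4)] by blast
    have "3 \<le> length p"
    proof (rule ccontr)
      assume "\<not> 3 \<le> length p"
      then consider "p = []" | x where "p = [x]" | x y where "p = [x, y]"
        by (cases p; cases "tl p"; cases "tl (tl p)") auto
      then show False
        using p(2) e(1,2) by cases (simp_all add: walk_def adjacent_def)
    qed
    moreover have "successively (adjacent (Graph V E)) p"
      using p(2) unfolding walk_def
      by (auto simp: adjacent_def intro: successively_mono[of "adjacent (Graph V (E - {e}))"])
    moreover have "adjacent (Graph V E) (last p) (hd p)"
      using p(2) e \<open>e \<in> E\<close> by (auto simp: walk_def adjacent_def insert_commute)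
    ultimately have "is_cycle (Graph V E) p"
      using p by (auto simp: is_cycle_def walk_def)
    with acyc show False by blast
  qed
  with con show "min_connected V E"
    by (auto simp: min_connected_def)
next
  assume M: "min_connected V E"
  then have con: "cut_connected V E"
    by (simp add: min_connected_def)
  have "\<not> is_cycle (Graph V E) c" for c
  proof
    assume c: "is_cycle (Graph V E) c"
    then have "{last c, hd c} \<in> E"
      by (simp add: is_cycle_def adjacent_def)
    with M cut_connected_delete_cycle_edge[OF con c] show False
      by (simp add: min_connected_def)
  qed
  with con assms show "tree (Graph V E)"
    by (auto simp: tree_def connected_graph_iff_cut_connected)
qed

lemma spanning_trees_eq:
  assumes "simple_graph (Graph V E)"
  shows "spanning_trees (Graph V E) = Graph V ` spanning_edge_sets V E"
proof -
  have sub: "simple_graph (Graph V F)" if "F \<subseteq> E" for F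
    using assms that by (auto simp: simple_graph_def)
  have "T \<in> spanning_trees (Graph V E) \<longleftrightarrow> T \<in> Graph V ` spanning_edge_sets V E" for T
  proof (cases T)
    case (Graph W F)
    then show ?thesis
      using sub[of F] tree_iff_min_connected[of V F]
      by (auto simp: spanning_trees_def spanning_edge_sets_def image_iff)
  qed
  then show ?thesis by blast
qed

section \<open>Bridges, leaves and vertices of degree two\<close>

text \<open>
  A cut of \<open>V1\<close>, rooted at the end \<open>a\<close> of the bridge, is not crossed by the bridge, and therefore
  \<open>E1\<close> alone connects \<open>V1\<close>. Conversely, the only cut that induces no proper cut on either side is
  the one that separates \<open>V1\<close> from \<open>V2\<close>.
\<close>

lemma cut_connected_bridge:
  assumes "V1 \<inter> V2 = {}" "E1 \<subseteq> Pow V1" "E2 \<subseteq> Pow V2" "a \<in> V1" "b \<in> V2"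
  shows "cut_connected (V1 \<union> V2) (insert {a, b} (E1 \<union> E2)) \<longleftrightarrow>
    cut_connected V1 E1 \<and> cut_connected V2 E2" (is "?L \<longleftrightarrow> ?R")
proof
  assume L: ?L
  have half: "cut_connected V1 E1"
    if L: "cut_connected (V1 \<union> V2) (insert {a, b} (E1 \<union> E2))"
      and "V1 \<inter> V2 = {}" "E1 \<subseteq> Pow V1" "E2 \<subseteq> Pow V2" "a \<in> V1" "b \<in> V2"
    for V1 V2 :: "'a set" and E1 E2 a b
    unfolding cut_connected_rooted[OF \<open>a \<in> V1\<close>]
  proof (intro allI impI)
    fix S assume S: "S \<subseteq> V1 - {a} \<and> S \<noteq> {}"
    then obtain x y where xy: "x \<in> S" "y \<in> V1 \<union> V2" "y \<notin> S" "{x, y} \<in> insert {a, b} (E1 \<union> E2)"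
      using cut_connected_crossing[OF L, of S a] \<open>a \<in> V1\<close> by blast
    have "x \<notin> {a, b}" "x \<notin> V2"
      using xy S that by blast+
    then have "{x, y} \<in> E1"
      using xy that by (auto simp: doubleton_eq_iff)
    with xy that show "\<exists>x\<in>S. \<exists>y\<in>V1 - S. {x, y} \<in> E1" by blast
  qed
  from L have L': "cut_connected (V2 \<union> V1) (insert {b, a} (E2 \<union> E1))"
    by (simp add: Un_commute insert_commute)
  show ?R
    using half[OF L] half[OF L'] assms by blast
next
  assume R: ?R
  have "\<exists>x\<in>S. \<exists>y\<in>V1 \<union> V2 - S. {x, y} \<in> insert {a, b} (E1 \<union> E2)"
    if S: "S \<subseteq> V1 \<union> V2" "S \<noteq> {}" "S \<noteq> V1 \<union> V2" for S
  proof -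
    consider "S \<inter> V1 \<noteq> {}" "S \<inter> V1 \<noteq> V1" | "S \<inter> V2 \<noteq> {}" "S \<inter> V2 \<noteq> V2" | "S = V1" | "S = V2"
      using S by blast
    then show ?thesis
    proof cases
      case 1
      then obtain x y where "x \<in> S \<inter> V1" "y \<in> V1 - S \<inter> V1" "{x, y} \<in> E1"
        using R unfolding cut_connected_def by (metis inf_le2)
      then show ?thesis by blast
    next
      case 2
      then obtain x y where "x \<in> S \<inter> V2" "y \<in> V2 - S \<inter> V2" "{x, y} \<in> E2"
        using R unfolding cut_connected_def by (metis inf_le2)
      then show ?thesis by blast
    next
      case 3
      with assms show ?thesis by blast
    next
      case 4
      with assms have "b \<in> S" "a \<in> V1 \<union> V2 - S" "{b, a} \<in> insert {a, b} (E1 \<union> E2)"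
        by (auto simp: insert_commute)
      then show ?thesis by blast
    qed
  qed
  with assms show ?L
    unfolding cut_connected_def by blast
qed

lemma not_cut_connected_union:
  assumes "V1 \<inter> V2 = {}" "E1 \<subseteq> Pow V1" "E2 \<subseteq> Pow V2" "V1 \<noteq> {}" "V2 \<noteq> {}"
  shows "\<not> cut_connected (V1 \<union> V2) (E1 \<union> E2)"
proof
  assume "cut_connected (V1 \<union> V2) (E1 \<union> E2)"
  moreover have "V1 \<subseteq> V1 \<union> V2" "V1 \<noteq> V1 \<union> V2"
    using assms by blast+
  ultimately obtain x y where "x \<in> V1" "y \<in> V2" "{x, y} \<in> E1 \<union> E2"
    using assms unfolding cut_connected_def by blast
  with assms show False by blast
qed

text \<open>
  The condition on \<open>{}\<close>, the only possible common element of \<open>E1\<close> and \<open>E2\<close>, makes them disjoint, so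
  that every edge other than the bridge is deleted from exactly one side.
\<close>

lemma min_connected_bridge:
  assumes "V1 \<inter> V2 = {}" "E1 \<subseteq> Pow V1" "E2 \<subseteq> Pow V2" "a \<in> V1" "b \<in> V2" "{} \<notin> E2"
  shows "min_connected (V1 \<union> V2) (insert {a, b} (E1 \<union> E2)) \<longleftrightarrow>
    min_connected V1 E1 \<and> min_connected V2 E2"
proof -
  let ?E = "insert {a, b} (E1 \<union> E2)"
  have new: "{a, b} \<notin> E1 \<union> E2"
    using assms by blast
  then have "?E - {{a, b}} = E1 \<union> E2"
    by auto
  then have bridge: "\<not> cut_connected (V1 \<union> V2) (?E - {{a, b}})"
    using not_cut_connected_union[OF assms(1-3)] assms(4,5) by auto
  have left: "cut_connected (V1 \<union> V2) (?E - {e}) \<longleftrightarrow> cut_connected V1 (E1 - {e}) \<and> cut_connected V2 E2"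
    if "e \<in> E1" for e
  proof -
    have "e \<notin> E2"
    proof
      assume "e \<in> E2"
      with that assms(1-3) have "e = {}" by blast
      with \<open>e \<in> E2\<close> assms(6) show False by simp
    qed
    then have "?E - {e} = insert {a, b} ((E1 - {e}) \<union> E2)"
      using that new by auto
    moreover have "E1 - {e} \<subseteq> Pow V1"
      using assms(2) by auto
    ultimately show ?thesis
      using cut_connected_bridge[OF assms(1) _ assms(3-5)] by simp
  qed
  have right: "cut_connected (V1 \<union> V2) (?E - {e}) \<longleftrightarrow> cut_connected V1 E1 \<and> cut_connected V2 (E2 - {e})"
    if "e \<in> E2" for e
  proof -
    have "e \<notin> E1"
    proof
      assume "e \<in> E1"
      with that assms(1-3) have "e = {}" by blast
      with that assms(6) show False by simp
    qed
    then have "?E - {e} = insert {a, b} (E1 \<union> (E2 - {e}))"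
      using that new by auto
    moreover have "E2 - {e} \<subseteq> Pow V2"
      using assms(3) by auto
    ultimately show ?thesis
      using cut_connected_bridge[OF assms(1,2) _ assms(4,5)] by simp
  qed
  have "(\<forall>e\<in>?E. \<not> cut_connected (V1 \<union> V2) (?E - {e})) \<longleftrightarrow>
      (\<forall>e\<in>E1. \<not> (cut_connected V1 (E1 - {e}) \<and> cut_connected V2 E2)) \<and>
      (\<forall>e\<in>E2. \<not> (cut_connected V1 E1 \<and> cut_connected V2 (E2 - {e})))"
    unfolding ball_simps ball_Un using bridge left right by simp
  then show ?thesis
    unfolding min_connected_def cut_connected_bridge[OF assms(1-5)] by auto
qed

lemma cut_connected_singleton: "cut_connected {v} E"
  by (auto simp: cut_connected_def subset_singleton_iff)

lemma min_connected_singleton: "min_connected {v} E \<longleftrightarrow> E = {}"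
  by (auto simp: min_connected_def cut_connected_singleton)

text \<open>
  From left to right, cuts of \<open>V\<close> avoid \<open>a\<close>: those containing \<open>b\<close> are crossed by \<open>{a, b}\<close>, and the
  others are also cuts of the larger graph not crossed at \<open>v\<close>. From right to left, cuts avoid \<open>v\<close>,
  and those not crossed at \<open>v\<close> avoid both \<open>a\<close> and \<open>b\<close>.
\<close>

lemma cut_connected_subdivide:
  assumes "v \<notin> V" "E \<subseteq> Pow V" "a \<in> V" "b \<in> V" "a \<noteq> b"
  shows "cut_connected (insert v V) (insert {v, a} (insert {v, b} E)) \<longleftrightarrow>
    cut_connected V (insert {a, b} E)" (is "?L \<longleftrightarrow> ?R")
proof
  assume L: ?L
  show ?R
    unfolding cut_connected_rooted[OF \<open>a \<in> V\<close>]
  proof (intro allI impI)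
    fix S assume S: "S \<subseteq> V - {a} \<and> S \<noteq> {}"
    show "\<exists>x\<in>S. \<exists>y\<in>V - S. {x, y} \<in> insert {a, b} E"
    proof (cases "b \<in> S")
      case True
      moreover have "a \<in> V - S" "{b, a} \<in> insert {a, b} E"
        using S assms by (auto simp: insert_commute)
      ultimately show ?thesis by blast
    next
      case False
      have "S \<subseteq> insert v V - {v} \<and> S \<noteq> {}"
        using S assms by blast
      then obtain x y where xy: "x \<in> S" "y \<in> insert v V" "y \<notin> S"
          "{x, y} \<in> insert {v, a} (insert {v, b} E)"
        using cut_connected_crossing[OF L, of S v] by blast
      have "x \<notin> {v, a, b}"
        using xy S False assms by blast
      with xy have "{x, y} \<in> E"
        by (auto simp: doubleton_eq_iff)
      with xy assms show ?thesis by blast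
    qed
  qed
next
  assume R: ?R
  have "v \<in> insert v V" by simp
  show ?L
    unfolding cut_connected_rooted[OF \<open>v \<in> insert v V\<close>]
  proof (intro allI impI)
    fix S assume S: "S \<subseteq> insert v V - {v} \<and> S \<noteq> {}"
    show "\<exists>x\<in>S. \<exists>y\<in>insert v V - S. {x, y} \<in> insert {v, a} (insert {v, b} E)"
    proof (cases "a \<in> S \<or> b \<in> S")
      case True
      moreover have "v \<in> insert v V - S" "{a, v} = {v, a}" "{b, v} = {v, b}"
        using S by auto
      ultimately show ?thesis by (metis insertCI)
    next
      case False
      have "S \<subseteq> V - {a} \<and> S \<noteq> {}"
        using S False by blast
      then obtain x y where xy: "x \<in> S" "y \<in> V" "y \<notin> S" "{x, y} \<in> insert {a, b} E"
        using cut_connected_crossing[OF R, of S a] \<open>a \<in> V\<close> by blast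
      then have "{x, y} \<in> E"
        using False by (auto simp: doubleton_eq_iff)
      with xy show ?thesis by blast
    qed
  qed
qed

lemma cut_connected_pendant:
  assumes "v \<notin> V" "E \<subseteq> Pow V" "a \<in> V"
  shows "cut_connected (insert v V) (insert {v, a} E) \<longleftrightarrow> cut_connected V E"
  using cut_connected_bridge[of V "{v}" E "{}" a v] assms
  by (simp add: insert_commute[of v a] cut_connected_singleton)

lemma min_connected_pendant:
  assumes "v \<notin> V" "E \<subseteq> Pow V" "a \<in> V"
  shows "min_connected (insert v V) (insert {v, a} E) \<longleftrightarrow> min_connected V E"
  using min_connected_bridge[of V "{v}" E "{}" a v] assms
  by (simp add: insert_commute[of v a] min_connected_singleton)

text \<open>
  If \<open>{a, b}\<close> already belongs to \<open>E\<close>, the left-hand graph contains the triangle on \<open>v, a, b\<close> and is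
  not minimal. Otherwise the deletable edges correspond, where either edge at \<open>v\<close> plays the role
  of \<open>{a, b}\<close>: deleting one of them turns the other into a pendant edge.
\<close>

lemma min_connected_subdivide:
  assumes "v \<notin> V" "E \<subseteq> Pow V" "a \<in> V" "b \<in> V" "a \<noteq> b"
  shows "min_connected (insert v V) (insert {v, a} (insert {v, b} E)) \<longleftrightarrow>
    {a, b} \<notin> E \<and> min_connected V (insert {a, b} E)"
proof (cases "{a, b} \<in> E")
  case True
  let ?F = "insert {v, a} (insert {v, b} E)"
  have "?F - {{a, b}} = insert {v, a} (insert {v, b} (E - {{a, b}}))"
    using assms by (auto simp: doubleton_eq_iff)
  moreover have "E - {{a, b}} \<subseteq> Pow V" "insert {a, b} (E - {{a, b}}) = insert {a, b} E"
    using assms by blast+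
  ultimately have "cut_connected (insert v V) ?F \<longleftrightarrow> cut_connected (insert v V) (?F - {{a, b}})"
    using cut_connected_subdivide[of v V] assms by metis
  with True show ?thesis
    by (auto simp: min_connected_def)
next
  case False
  let ?F = "insert {v, a} (insert {v, b} E)"
  have new: "{v, a} \<notin> E" "{v, b} \<notin> E" "{v, a} \<noteq> {v, b}"
    using assms by (auto simp: doubleton_eq_iff)
  have "cut_connected (insert v V) (?F - {{v, a}}) \<longleftrightarrow> cut_connected V E"
    using new cut_connected_pendant[of v V E b] assms by (simp add: insert_Diff_if)
  moreover have "cut_connected (insert v V) (?F - {{v, b}}) \<longleftrightarrow> cut_connected V E"
    using new cut_connected_pendant[of v V E a] assms by (simp add: insert_Diff_if)
  moreover have "cut_connected (insert v V) (?F - {e}) \<longleftrightarrow> cut_connected V (insert {a, b} E - {e})"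
    if "e \<in> E" for e
  proof -
    have "?F - {e} = insert {v, a} (insert {v, b} (E - {e}))"
      "insert {a, b} E - {e} = insert {a, b} (E - {e})"
      using that new False by auto
    moreover have "E - {e} \<subseteq> Pow V"
      using assms by blast
    ultimately show ?thesis
      using cut_connected_subdivide[of v V "E - {e}" a b] assms by simp
  qed
  moreover have "insert {a, b} E - {{a, b}} = E"
    using False by simp
  ultimately show ?thesis
    unfolding min_connected_def cut_connected_subdivide[OF assms] using False by auto
qed

section \<open>Counting spanning trees\<close>

lemma finite_spanning_edge_sets: "finite E \<Longrightarrow> finite (spanning_edge_sets V E)"
  by (rule finite_subset[of _ "Pow E"]) (auto simp: spanning_edge_sets_def)

text \<open>
  Every spanning tree uses the bridge, since the rest of the edges does not connect the two sides.
\<close>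

lemma card_spanning_edge_sets_bridge:
  assumes "V1 \<inter> V2 = {}" "E1 \<subseteq> Pow V1" "E2 \<subseteq> Pow V2" "a \<in> V1" "b \<in> V2" "{} \<notin> E2"
  shows "card (spanning_edge_sets (V1 \<union> V2) (insert {a, b} (E1 \<union> E2))) =
    card (spanning_edge_sets V1 E1) * card (spanning_edge_sets V2 E2)"
proof -
  let ?g = "\<lambda>(F1, F2). insert {a, b} (F1 \<union> F2)"
  have disj: "E1 \<inter> E2 = {}" "{a, b} \<notin> E1" "{a, b} \<notin> E2"
  proof -
    have "e = {}" if "e \<in> E1" "e \<in> E2" for e
      using that assms(1-3) by blast
    then show "E1 \<inter> E2 = {}"
      using assms(6) by auto
    show "{a, b} \<notin> E1"
      using assms(1,2,5) by blast
    show "{a, b} \<notin> E2"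
      using assms(1,3,4) by blast
  qed
  have "bij_betw ?g (spanning_edge_sets V1 E1 \<times> spanning_edge_sets V2 E2)
    (spanning_edge_sets (V1 \<union> V2) (insert {a, b} (E1 \<union> E2)))"
    unfolding bij_betw_def
  proof
    show "inj_on ?g (spanning_edge_sets V1 E1 \<times> spanning_edge_sets V2 E2)"
      by (rule inj_on_inverseI[where g = "\<lambda>F. (F \<inter> E1, F \<inter> E2)"])
        (use disj in \<open>auto simp: spanning_edge_sets_def\<close>)
  next
    have glue: "min_connected (V1 \<union> V2) (?g (F1, F2)) \<longleftrightarrow> min_connected V1 F1 \<and> min_connected V2 F2"
      if "F1 \<subseteq> E1" "F2 \<subseteq> E2" for F1 F2
    proof -
      have "F1 \<subseteq> Pow V1" "F2 \<subseteq> Pow V2" "{} \<notin> F2"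
        using that assms by auto
      then show ?thesis
        using min_connected_bridge[OF assms(1) _ _ assms(4,5)] by simp
    qed
    show "?g ` (spanning_edge_sets V1 E1 \<times> spanning_edge_sets V2 E2) =
      spanning_edge_sets (V1 \<union> V2) (insert {a, b} (E1 \<union> E2))"
    proof (intro equalityI subsetI)
      fix F assume "F \<in> ?g ` (spanning_edge_sets V1 E1 \<times> spanning_edge_sets V2 E2)"
      then obtain F1 F2 where F: "F = ?g (F1, F2)" "F1 \<subseteq> E1" "F2 \<subseteq> E2"
          "min_connected V1 F1" "min_connected V2 F2"
        by (auto simp: spanning_edge_sets_def)
      with glue[of F1 F2] have "min_connected (V1 \<union> V2) F" by simp
      with F show "F \<in> spanning_edge_sets (V1 \<union> V2) (insert {a, b} (E1 \<union> E2))"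
        by (auto simp: spanning_edge_sets_def)
    next
      fix F assume F: "F \<in> spanning_edge_sets (V1 \<union> V2) (insert {a, b} (E1 \<union> E2))"
      have "{a, b} \<in> F"
      proof (rule ccontr)
        assume "{a, b} \<notin> F"
        then have "F = F \<inter> E1 \<union> F \<inter> E2"
          using F by (auto simp: spanning_edge_sets_def)
        moreover have "\<not> cut_connected (V1 \<union> V2) (F \<inter> E1 \<union> F \<inter> E2)"
          using assms by (intro not_cut_connected_union) auto
        ultimately show False
          using F by (auto simp: spanning_edge_sets_def min_connected_def)
      qed
      then have eq: "F = ?g (F \<inter> E1, F \<inter> E2)"
        using F by (auto simp: spanning_edge_sets_def)
      then have "min_connected V1 (F \<inter> E1)" "min_connected V2 (F \<inter> E2)"
        using F glue[of "F \<inter> E1" "F \<inter> E2"] by (auto simp: spanning_edge_sets_def)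
      then have "(F \<inter> E1, F \<inter> E2) \<in> spanning_edge_sets V1 E1 \<times> spanning_edge_sets V2 E2"
        by (auto simp: spanning_edge_sets_def)
      with eq show "F \<in> ?g ` (spanning_edge_sets V1 E1 \<times> spanning_edge_sets V2 E2)"
        by blast
    qed
  qed
  from bij_betw_same_card[OF this] show ?thesis
    by (simp only: card_cartesian_product)
qed

text \<open>
  The spanning trees with leaf \<open>v\<close> arise from the spanning trees of the graph without \<open>v\<close> by
  attaching \<open>v\<close> with any of its edges.
\<close>

lemma card_spanning_edge_sets_leaf:
  assumes "v \<in> V" and E: "\<forall>e\<in>E. e \<subseteq> V \<and> card e = 2"
  shows "card {F \<in> spanning_edge_sets V E. card {e \<in> F. v \<in> e} = 1} =
    card {e \<in> E. v \<in> e} * card (spanning_edge_sets (V - {v}) {e \<in> E. v \<notin> e})"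
proof -
  let ?A = "{e \<in> E. v \<in> e}" and ?B = "spanning_edge_sets (V - {v}) {e \<in> E. v \<notin> e}"
  let ?C = "{F \<in> spanning_edge_sets V E. card {e \<in> F. v \<in> e} = 1}"
  have pend: "min_connected V (insert e F) \<longleftrightarrow> min_connected (V - {v}) F"
    if "e \<in> ?A" "F \<subseteq> {e \<in> E. v \<notin> e}" for e F
  proof -
    have "card e = 2" "e \<subseteq> V" "v \<in> e"
      using that E by auto
    then obtain u where "e = {v, u}" "u \<in> V - {v}"
      by (auto simp: card_2_iff doubleton_eq_iff)
    moreover have "F \<subseteq> Pow (V - {v})"
      using that E by blast
    ultimately show ?thesis
      using min_connected_pendant[of v "V - {v}" F u] \<open>v \<in> V\<close> by (simp add: insert_absorb)
  qed
  have star: "{e' \<in> insert e F. v \<in> e'} = {e}" if "e \<in> ?A" "F \<subseteq> {e \<in> E. v \<notin> e}" for e F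
    using that by auto
  have "bij_betw (\<lambda>(e, F). insert e F) (?A \<times> ?B) ?C"
    unfolding bij_betw_def
  proof
    have "e = e' \<and> F = F'"
      if "e \<in> ?A" "F \<subseteq> {e \<in> E. v \<notin> e}" "e' \<in> ?A" "F' \<subseteq> {e \<in> E. v \<notin> e}" "insert e F = insert e' F'"
      for e e' F F'
    proof -
      have "e \<in> insert e' F'"
        using that(5) by blast
      then have "e = e'"
        using that(1,4) by auto
      moreover have "e \<notin> F" "e' \<notin> F'"
        using that by auto
      ultimately show ?thesis
        using that(5) by (simp add: insert_ident)
    qed
    then show "inj_on (\<lambda>(e, F). insert e F) (?A \<times> ?B)"
      by (auto simp: inj_on_def spanning_edge_sets_def)
  next
    show "(\<lambda>(e, F). insert e F) ` (?A \<times> ?B) = ?C"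
    proof (intro equalityI subsetI)
      fix G assume "G \<in> (\<lambda>(e, F). insert e F) ` (?A \<times> ?B)"
      then obtain e F where G: "G = insert e F" "e \<in> ?A" "F \<subseteq> {e \<in> E. v \<notin> e}" "min_connected (V - {v}) F"
        by (auto simp: spanning_edge_sets_def)
      then have "min_connected V G" "card {e \<in> G. v \<in> e} = 1"
        using pend star by auto
      with G show "G \<in> ?C"
        by (auto simp: spanning_edge_sets_def)
    next
      fix G assume G: "G \<in> ?C"
      then obtain e where e: "{e \<in> G. v \<in> e} = {e}"
        by (auto simp: card_1_singleton_iff)
      define F where "F = {e \<in> G. v \<notin> e}"
      have "G = insert e F" "e \<in> ?A" "F \<subseteq> {e \<in> E. v \<notin> e}"
        using e G by (auto simp: F_def spanning_edge_sets_def)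
      moreover from this have "F \<in> ?B"
        using pend[of e F] G by (auto simp: spanning_edge_sets_def)
      ultimately show "G \<in> (\<lambda>(e, F). insert e F) ` (?A \<times> ?B)"
        by force
    qed
  qed
  from bij_betw_same_card[OF this] show ?thesis
    by (simp only: card_cartesian_product)
qed

text \<open>
  A new vertex \<open>v\<close> is put on the edge \<open>{a, b}\<close> to form a triangle. In a spanning tree it is a leaf at \<open>a\<close>, a
  leaf at \<open>b\<close>, or it subdivides the edge \<open>{a, b}\<close> of a smaller spanning tree.
\<close>

lemma spanning_edge_sets_triangle:
  assumes "v \<notin> V" "E \<subseteq> Pow V" "{a, b} \<in> E" "a \<noteq> b"
  defines "X \<equiv> spanning_edge_sets V E"
  shows "spanning_edge_sets (insert v V) (insert {v, a} (insert {v, b} E)) =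
    insert {v, a} ` X \<union> insert {v, b} ` X \<union>
    (\<lambda>F. insert {v, a} (insert {v, b} (F - {{a, b}}))) ` {F \<in> X. {a, b} \<in> F}"
    (is "?L = ?A \<union> ?B \<union> ?C")
proof -
  have ab: "a \<in> V" "b \<in> V" "v \<noteq> a" "v \<noteq> b"
    using assms by auto
  have new: "{v, a} \<notin> E" "{v, b} \<notin> E" "{v, a} \<noteq> {v, b}"
    using assms by (auto simp: doubleton_eq_iff)
  have pend: "min_connected (insert v V) (insert {v, x} F) \<longleftrightarrow> min_connected V F"
    if "F \<subseteq> E" "x \<in> {a, b}" for F x
    using that assms ab min_connected_pendant[of v V F x] by blast
  have subd: "min_connected (insert v V) (insert {v, a} (insert {v, b} F)) \<longleftrightarrow>
      {a, b} \<notin> F \<and> min_connected V (insert {a, b} F)" if "F \<subseteq> E" for F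
    using that assms ab min_connected_subdivide[of v V F a b] by blast
  have AB: "?A \<subseteq> ?L" "?B \<subseteq> ?L"
    using pend by (auto simp: X_def spanning_edge_sets_def)
  have C: "?C \<subseteq> ?L"
  proof
    fix G assume "G \<in> ?C"
    then obtain F where F: "F \<subseteq> E" "min_connected V F" "{a, b} \<in> F"
        "G = insert {v, a} (insert {v, b} (F - {{a, b}}))"
      by (auto simp: X_def spanning_edge_sets_def)
    then have "insert {a, b} (F - {{a, b}}) = F" by blast
    with F subd[of "F - {{a, b}}"] have "min_connected (insert v V) G" by auto
    with F show "G \<in> ?L" by (auto simp: spanning_edge_sets_def)
  qed
  have D: "G \<in> ?A \<union> ?B \<union> ?C" if "G \<in> ?L" for G
  proof -
    define F where "F = G \<inter> E"
    have G: "G \<subseteq> insert {v, a} (insert {v, b} E)" "min_connected (insert v V) G" "F \<subseteq> E"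
      using that by (auto simp: spanning_edge_sets_def F_def)
    consider "G = F" | "G = insert {v, a} F" | "G = insert {v, b} F"
      | "G = insert {v, a} (insert {v, b} F)"
      using G(1) unfolding F_def by blast
    then show ?thesis
    proof cases
      case 1
      have "\<not> cut_connected ({v} \<union> V) ({} \<union> F)"
        using G assms ab by (intro not_cut_connected_union) auto
      with G 1 show ?thesis by (simp add: min_connected_def)
    next
      case 2
      with G pend[of F a] show ?thesis by (auto simp: X_def spanning_edge_sets_def)
    next
      case 3
      with G pend[of F b] show ?thesis by (auto simp: X_def spanning_edge_sets_def)
    next
      case 4
      with G subd[of F] have "{a, b} \<notin> F" "min_connected V (insert {a, b} F)" by auto
      then have "insert {a, b} F \<in> {F \<in> X. {a, b} \<in> F}" "F = insert {a, b} F - {{a, b}}"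
        using G assms by (auto simp: X_def spanning_edge_sets_def)
      with 4 show ?thesis by blast
    qed
  qed
  show ?thesis
    by (intro equalityI subsetI D Un_least AB C)
qed

text \<open>
  Counting the trees through \<open>{v, a}\<close> as well allows for iteration, with the triangle on
  \<open>{v, a}\<close> as the next one.
\<close>

lemma card_spanning_edge_sets_triangle:
  assumes "v \<notin> V" "E \<subseteq> Pow V" "{a, b} \<in> E" "a \<noteq> b" "finite E"
  defines "X \<equiv> spanning_edge_sets V E"
    and "Y \<equiv> spanning_edge_sets (insert v V) (insert {v, a} (insert {v, b} E))"
  shows "card Y = 2 * card X + card {F \<in> X. {a, b} \<in> F}"
    and "card {F \<in> Y. {v, a} \<in> F} = card X + card {F \<in> X. {a, b} \<in> F}"
proof -
  let ?h = "\<lambda>F. insert {v, a} (insert {v, b} (F - {{a, b}}))"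
  let ?Z = "{F \<in> X. {a, b} \<in> F}"
  have new: "{v, a} \<notin> E" "{v, b} \<notin> E" "{v, a} \<noteq> {v, b}"
    using assms by (auto simp: doubleton_eq_iff)
  have XE: "F \<subseteq> E" if "F \<in> X" for F
    using that by (auto simp: X_def spanning_edge_sets_def)
  have fin: "finite X"
    using assms finite_spanning_edge_sets by blast
  define P where "P = insert {v, a} ` X"
  define Q where "Q = insert {v, b} ` X"
  define R where "R = ?h ` ?Z"
  have Y: "Y = P \<union> Q \<union> R"
    unfolding Y_def X_def P_def Q_def R_def using assms(1-4) by (rule spanning_edge_sets_triangle)
  have "inj_on (insert {v, a}) X" "inj_on (insert {v, b}) X"
    using new XE by (auto intro!: inj_on_inverseI[where g = "\<lambda>G. G \<inter> E"])
  moreover have "insert {a, b} (?h F \<inter> E) = F" if "F \<in> ?Z" for F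
    using that XE[of F] new by auto
  then have "inj_on ?h ?Z"
    by (rule inj_on_inverseI[where g = "\<lambda>G. insert {a, b} (G \<inter> E)"])
  ultimately have card: "card P = card X" "card Q = card X" "card R = card ?Z"
    unfolding P_def Q_def R_def by (simp_all add: card_image)
  have fin': "finite P" "finite Q" "finite R"
    unfolding P_def Q_def R_def using fin by auto
  \<comment> \<open>The three families differ in which of the two new edges they contain.\<close>
  have A: "{v, a} \<in> G \<and> {v, b} \<notin> G" if "G \<in> P" for G
    using that new XE by (auto simp: P_def)
  have B: "{v, a} \<notin> G \<and> {v, b} \<in> G" if "G \<in> Q" for G
    using that new XE by (auto simp: Q_def)
  have C: "{v, a} \<in> G \<and> {v, b} \<in> G" if "G \<in> R" for G
    using that by (auto simp: R_def)
  have disj: "P \<inter> Q = {}" "(P \<union> Q) \<inter> R = {}" "P \<inter> R = {}"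
    by (auto dest: A B C)
  show "card Y = 2 * card X + card ?Z"
    unfolding Y using fin' disj card by (simp add: card_Un_disjoint)
  have "{F \<in> Y. {v, a} \<in> F} = P \<union> R"
    unfolding Y by (auto dest: A B C)
  then show "card {F \<in> Y. {v, a} \<in> F} = card X + card ?Z"
    using fin' disj card by (simp add: card_Un_disjoint)
qed

section \<open>Strips of triangles\<close>

text \<open>
  The square of a path is needed on arbitrary intervals \<open>{a..<b}\<close>, because deleting a vertex leaves
  one interval on either side.
\<close>

definition strip :: "nat \<Rightarrow> nat \<Rightarrow> nat set set" where
  "strip a b = {{i, j} |i j. a \<le> i \<and> i < j \<and> j < b \<and> j \<le> i + 2}"

lemma strip_edge: "e \<in> strip a b \<Longrightarrow> e \<subseteq> {a..<b} \<and> card e = 2"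
  by (auto simp: strip_def)

lemma finite_strip: "finite (strip a b)"
  by (rule finite_subset[of _ "Pow {a..<b}"]) (auto simp: strip_def)

lemma doubleton_in_strip:
  "{u, v} \<in> strip a b \<longleftrightarrow>
    u \<noteq> v \<and> a \<le> u \<and> a \<le> v \<and> u < b \<and> v < b \<and> u \<le> v + 2 \<and> v \<le> u + 2"
proof -
  have "{u, v} \<in> strip a b \<longleftrightarrow>
    (\<exists>i j. (u = i \<and> v = j \<or> u = j \<and> v = i) \<and> a \<le> i \<and> i < j \<and> j < b \<and> j \<le> i + 2)"
    by (simp add: strip_def doubleton_eq_iff)
  also have "\<dots> \<longleftrightarrow> (a \<le> u \<and> u < v \<and> v < b \<and> v \<le> u + 2) \<or> (a \<le> v \<and> v < u \<and> u < b \<and> u \<le> v + 2)"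
    by auto
  also have "\<dots> \<longleftrightarrow> u \<noteq> v \<and> a \<le> u \<and> a \<le> v \<and> u < b \<and> v < b \<and> u \<le> v + 2 \<and> v \<le> u + 2"
    by linarith
  finally show ?thesis .
qed

lemma strip_empty: "b \<le> a + 1 \<Longrightarrow> strip a b = {}"
  by (auto simp: strip_def)

lemma strip_two: "strip a (a + 2) = {{a, a + 1}}"
proof -
  have "i = a \<and> j = a + 1" if "a \<le> i" "i < j" "j < a + 2" for i j
    using that by linarith
  then show ?thesis
    by (force simp: strip_def)
qed

lemma strip_extend:
  assumes "a + 2 \<le> b"
  shows "strip a (Suc b) = insert {b, b - 1} (insert {b, b - 2} (strip a b))"
proof (intro equalityI subsetI)
  fix e assume "e \<in> strip a (Suc b)"
  then obtain i j where e: "e = {i, j}" "a \<le> i" "i < j" "j < Suc b" "j \<le> i + 2"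
    by (auto simp: strip_def)
  then consider "j < b" | "j = b" "i = b - 1" | "j = b" "i = b - 2"
    by linarith
  then show "e \<in> insert {b, b - 1} (insert {b, b - 2} (strip a b))"
    using e by cases (auto simp: doubleton_in_strip insert_commute)
next
  fix e assume "e \<in> insert {b, b - 1} (insert {b, b - 2} (strip a b))"
  moreover from this obtain u w where "e = {u, w}"
    by (auto simp: strip_def)
  ultimately show "e \<in> strip a (Suc b)"
    using assms by (auto simp: doubleton_in_strip doubleton_eq_iff)
qed

text \<open>
  Each new vertex forms a triangle with the last edge of the strip. If \<open>x\<close> and \<open>y\<close> are the
  numbers of all spanning trees and of those containing the last edge, the next values are
  \<open>2 * x + y\<close> and \<open>x + y\<close>, which are two steps of the Fibonacci recurrence.
\<close>

lemma card_spanning_edge_sets_strip_fib: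
  "card (spanning_edge_sets {a..<a + n + 2} (strip a (a + n + 2))) = fib (2 * n + 2) \<and>
   card {F \<in> spanning_edge_sets {a..<a + n + 2} (strip a (a + n + 2)). {a + n + 1, a + n} \<in> F} = fib (2 * n + 1)"
proof (induction n)
  case 0
  have V: "{a..<a + 2} = insert (a + 1) {a}"
    by auto
  have "min_connected {a..<a + 2} F \<longleftrightarrow> F = {{a, a + 1}}" if "F \<subseteq> {{a, a + 1}}" for F
  proof -
    have "\<not> cut_connected ({a + 1} \<union> {a}) ({} \<union> {})"
      by (rule not_cut_connected_union) auto
    then have "\<not> min_connected {a..<a + 2} {}"
      unfolding V min_connected_def by (simp add: insert_commute)
    moreover have "min_connected {a..<a + 2} {{a, a + 1}}"
      using min_connected_pendant[of "a + 1" "{a}" "{}" a]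
      unfolding V by (simp add: min_connected_singleton insert_commute)
    ultimately show ?thesis
      using that by (auto simp: subset_singleton_iff)
  qed
  then have eq: "spanning_edge_sets {a..<a + 2} (strip a (a + 2)) = {{{a, a + 1}}}"
    unfolding spanning_edge_sets_def strip_two by auto
  have "{F \<in> {{{a, a + 1}}}. {a + 1, a} \<in> F} = {{{a, a + 1}}}"
    by (auto simp: insert_commute)
  then show ?case
    using eq by simp
next
  case (Suc n)
  let ?b = "a + n + 2"
  have "{a..<?b + 1} = insert ?b {a..<?b}"
    by auto
  moreover have "strip a (?b + 1) = insert {?b, a + n + 1} (insert {?b, a + n} (strip a ?b))"
    using strip_extend[of a ?b] by simp
  moreover have "strip a ?b \<subseteq> Pow {a..<?b}" "{a + n + 1, a + n} \<in> strip a ?b"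
    using strip_edge by (auto simp: doubleton_in_strip)
  ultimately show ?case
    using card_spanning_edge_sets_triangle[of ?b "{a..<?b}" "strip a ?b" "a + n + 1" "a + n"] Suc
    by (simp add: finite_strip algebra_simps)
qed

text \<open>
  A single vertex has one spanning tree, whereas the Fibonacci formula would give 0. The value 1 at 0 does not
  count anything; it is the neutral factor for the missing side when an end vertex is deleted.
\<close>

definition strip_trees :: "nat \<Rightarrow> nat" where
  "strip_trees n = (if n < 2 then 1 else fib (2 * n - 2))"

lemma card_spanning_edge_sets_strip:
  assumes "a < b"
  shows "card (spanning_edge_sets {a..<b} (strip a b)) = strip_trees (b - a)"
proof (cases "b = a + 1")
  case True
  have "{F. F \<subseteq> {} \<and> F = {}} = {{} :: nat set set}"
    by auto
  with True show ?thesis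
    by (simp add: spanning_edge_sets_def strip_empty min_connected_singleton strip_trees_def)
next
  case False
  with assms have "b = a + (b - a - 2) + 2"
    by simp
  then obtain n where "b = a + n + 2" ..
  then show ?thesis
    using card_spanning_edge_sets_strip_fib[of a n] by (simp add: strip_trees_def)
qed

section \<open>Deleting a vertex from a strip\<close>

lemma card_spanning_edge_sets_strip_delete:
  assumes "v < n" "2 \<le> n"
  shows "card (spanning_edge_sets ({..<n} - {v}) {e \<in> strip 0 n. v \<notin> e}) =
    strip_trees v * strip_trees (n - 1 - v)"
proof -
  define B where "B = (if 0 < v \<and> Suc v < n then {{v - 1, Suc v}} else {})"
  have E: "{e \<in> strip 0 n. v \<notin> e} = B \<union> (strip 0 v \<union> strip (Suc v) n)"
  proof (intro equalityI subsetI)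
    fix e assume "e \<in> {e \<in> strip 0 n. v \<notin> e}"
    then obtain i j where e: "e = {i, j}" "i < j" "j < n" "j \<le> i + 2" "v \<noteq> i" "v \<noteq> j"
      by (auto simp: strip_def)
    then consider "j < v" | "v < i" | "i = v - 1" "j = Suc v" "0 < v"
      by linarith
    then show "e \<in> B \<union> (strip 0 v \<union> strip (Suc v) n)"
      using e by cases (auto simp: doubleton_in_strip B_def)
  next
    fix e assume "e \<in> B \<union> (strip 0 v \<union> strip (Suc v) n)"
    moreover from this obtain i j where "e = {i, j}"
      by (auto simp: strip_def B_def split: if_splits)
    ultimately show "e \<in> {e \<in> strip 0 n. v \<notin> e}"
      using assms by (auto simp: doubleton_in_strip B_def doubleton_eq_iff split: if_splits)
  qed
  consider "v = 0" | "v = n - 1" "0 < v" | "0 < v" "Suc v < n"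
    using assms by linarith
  then show ?thesis
  proof cases
    case 1
    then have "{e \<in> strip 0 n. v \<notin> e} = strip 1 n"
      unfolding E by (simp add: B_def strip_empty)
    moreover have "{..<n} - {v} = {1..<n}"
      using 1 by auto
    ultimately show ?thesis
      using 1 assms card_spanning_edge_sets_strip[of 1 n] by (simp add: strip_trees_def[of 0])
  next
    case 2
    then have "{e \<in> strip 0 n. v \<notin> e} = strip 0 v"
      unfolding E by (simp add: B_def strip_empty)
    moreover have "{..<n} - {v} = {0..<v}"
      using 2 by auto
    ultimately show ?thesis
      using 2 card_spanning_edge_sets_strip[of 0 v] by (simp add: strip_trees_def[of 0])
  next
    case 3
    have "{e \<in> strip 0 n. v \<notin> e} = insert {v - 1, Suc v} (strip 0 v \<union> strip (Suc v) n)"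
      unfolding E using 3 by (simp add: B_def)
    moreover have "{..<n} - {v} = {0..<v} \<union> {Suc v..<n}"
      using 3 by auto
    moreover have "card (spanning_edge_sets ({0..<v} \<union> {Suc v..<n})
          (insert {v - 1, Suc v} (strip 0 v \<union> strip (Suc v) n))) =
        card (spanning_edge_sets {0..<v} (strip 0 v)) *
        card (spanning_edge_sets {Suc v..<n} (strip (Suc v) n))"
    proof (rule card_spanning_edge_sets_bridge)
      show "strip 0 v \<subseteq> Pow {0..<v}" "strip (Suc v) n \<subseteq> Pow {Suc v..<n}"
        using strip_edge by blast+
      show "{} \<notin> strip (Suc v) n"
        using strip_edge[of "{}"] by auto
    qed (use 3 in auto)
    ultimately show ?thesis
      using 3 card_spanning_edge_sets_strip[of 0 v] card_spanning_edge_sets_strip[of "Suc v" n]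
      by simp
  qed
qed

lemma card_edges_at_vertex_strip:
  assumes "4 \<le> n" "v < n"
  shows "card {e \<in> strip 0 n. v \<in> e} =
    (if v = 0 \<or> v = n - 1 then 2 else if v = 1 \<or> v = n - 2 then 3 else 4)"
proof -
  define N where "N = {u. u \<noteq> v \<and> u < n \<and> u \<le> v + 2 \<and> v \<le> u + 2}"
  have "{e \<in> strip 0 n. v \<in> e} = (\<lambda>u. {v, u}) ` N"
  proof (intro equalityI subsetI)
    fix e assume "e \<in> {e \<in> strip 0 n. v \<in> e}"
    then obtain u where "e = {v, u}" "{v, u} \<in> strip 0 n"
      by (auto simp: strip_def doubleton_in_strip insert_commute)
    then show "e \<in> (\<lambda>u. {v, u}) ` N"
      by (auto simp: N_def doubleton_in_strip)
  next
    fix e assume "e \<in> (\<lambda>u. {v, u}) ` N"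
    then show "e \<in> {e \<in> strip 0 n. v \<in> e}"
      using assms by (auto simp: N_def doubleton_in_strip)
  qed
  moreover have "inj_on (\<lambda>u. {v, u}) N"
    by (auto simp: inj_on_def doubleton_eq_iff)
  ultimately have deg: "card {e \<in> strip 0 n. v \<in> e} = card N"
    by (simp add: card_image)
  consider "v = 0" | "v = n - 1" | "v = 1" | "v = n - 2" | "2 \<le> v" "v + 2 < n"
    using assms by linarith
  then show ?thesis
  proof cases
    case 1
    then have "N = {1, 2}"
      using assms by (auto simp: N_def)
    with 1 deg show ?thesis by simp
  next
    case 2
    then have "N = {n - 2, n - 3}"
      using assms by (auto simp: N_def)
    with 2 deg assms show ?thesis by (simp add: card_insert_if)
  next
    case 3
    then have "N = {0, 2, 3}"
      using assms by (auto simp: N_def)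
    with 3 deg assms show ?thesis by simp
  next
    case 4
    then have "N = {n - 1, n - 3, n - 4}"
      using assms by (auto simp: N_def)
    moreover have "card {n - 1, n - 3, n - 4} = 3"
      using assms by (subst card_insert_disjoint; auto)+
    ultimately show ?thesis
      using 4 deg assms by auto
  next
    case 5
    then obtain k where k: "v = k + 2"
      by (metis add.commute le_iff_add)
    with 5 have "N = {k, k + 1, k + 3, k + 4}"
      by (auto simp: N_def)
    moreover have "v \<noteq> 0" "v \<noteq> 1" "v \<noteq> n - 1" "v \<noteq> n - 2"
      using 5 by linarith+
    ultimately show ?thesis
      using deg by simp
  qed
qed

section \<open>The square of a path\<close>

text \<open>
  Each step of a walk in the path changes the vertex by one.
\<close>

lemma walk_path_graph_bound:
  assumes "walk (path_graph n) u p v"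
  shows "u \<le> v + (length p - 1) \<and> v \<le> u + (length p - 1)"
proof -
  have "hd p \<le> last p + (length p - 1) \<and> last p \<le> hd p + (length p - 1)"
    if "successively (adjacent (path_graph n)) p" "p \<noteq> []" for p
    using that
  proof (induction p)
    case (Cons a p)
    show ?case
    proof (cases p)
      case (Cons b q)
      with Cons.prems have "a = Suc b \<or> b = Suc a"
        by (auto simp: adjacent_def path_graph_def doubleton_eq_iff)
      with Cons.IH Cons.prems Cons show ?thesis
        by auto
    qed simp
  qed simp
  with assms show ?thesis
    by (auto simp: walk_def)
qed

lemma distance_path_graph_ge:
  "enat (v - u) \<le> distance (path_graph n) u v" "enat (u - v) \<le> distance (path_graph n) u v"
  unfolding distance_def by (auto intro!: INF_greatest dest: walk_path_graph_bound)

lemma distance_path_graph_le_2: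
  assumes "u < n" "v < n" "u \<le> v + 2" "v \<le> u + 2"
  shows "distance (path_graph n) u v \<le> 2"
proof -
  have "\<exists>p. walk (path_graph n) u p v \<and> length p \<le> 3"
  proof -
    consider "v = u" | "v = u + 1" | "v = u + 2" | "u = v + 1" | "u = v + 2"
      using assms by linarith
    then show ?thesis
    proof cases
      case 1
      with assms show ?thesis
        by (intro exI[of _ "[u]"]) (simp add: walk_def path_graph_def)
    next
      case 2
      with assms show ?thesis
        by (intro exI[of _ "[u, v]"]) (auto simp: walk_def path_graph_def adjacent_def)
    next
      case 3
      with assms show ?thesis
        by (intro exI[of _ "[u, u + 1, v]"]) (auto simp: walk_def path_graph_def adjacent_def)
    next
      case 4
      with assms show ?thesis
        by (intro exI[of _ "[u, v]"]) (auto simp: walk_def path_graph_def adjacent_def)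
    next
      case 5
      with assms show ?thesis
        by (intro exI[of _ "[u, v + 1, v]"]) (auto simp: walk_def path_graph_def adjacent_def)
    qed
  qed
  then obtain p where p: "walk (path_graph n) u p v" "length p \<le> 3"
    by blast
  then have "distance (path_graph n) u v \<le> enat (length p - 1)"
    unfolding distance_def by (intro INF_lower) simp
  also have "\<dots> \<le> 2"
    using p by (simp add: numeral_eq_enat)
  finally show ?thesis .
qed

lemma path_graph_square: "graph_power (path_graph n) 2 = Graph {..<n} (strip 0 n)"
proof -
  have iff: "1 \<le> distance (path_graph n) u v \<and> distance (path_graph n) u v \<le> enat 2 \<longleftrightarrow>
      {u, v} \<in> strip 0 n" if uv: "u < n" "v < n" for u v
  proof
    assume d: "1 \<le> distance (path_graph n) u v \<and> distance (path_graph n) u v \<le> enat 2"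
    have "u \<noteq> v"
      using d distance_self[of u "path_graph n"] uv by (auto simp: path_graph_def)
    moreover have "enat (v - u) \<le> enat 2" "enat (u - v) \<le> enat 2"
      using d distance_path_graph_ge[where n = n and u = u and v = v] order_trans by blast+
    ultimately show "{u, v} \<in> strip 0 n"
      using uv by (auto simp: doubleton_in_strip)
  next
    assume s: "{u, v} \<in> strip 0 n"
    then have "1 \<le> enat (v - u) \<or> 1 \<le> enat (u - v)"
      by (auto simp: doubleton_in_strip one_enat_def)
    then have "1 \<le> distance (path_graph n) u v"
      using distance_path_graph_ge[where n = n and u = u and v = v] order_trans by blast
    moreover have "distance (path_graph n) u v \<le> enat 2"
      using distance_path_graph_le_2[of u n v] s by (simp add: doubleton_in_strip numeral_eq_enat)
    ultimately show "1 \<le> distance (path_graph n) u v \<and> distance (path_graph n) u v \<le> enat 2"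
      by blast
  qed
  have "{{u, v} |u v. u \<in> {..<n} \<and> v \<in> {..<n} \<and> 1 \<le> distance (path_graph n) u v \<and>
      distance (path_graph n) u v \<le> enat 2} = strip 0 n" (is "?E = _")
  proof (intro equalityI subsetI)
    fix e assume "e \<in> ?E"
    with iff show "e \<in> strip 0 n" by auto
  next
    fix e assume e: "e \<in> strip 0 n"
    then obtain u v where "e = {u, v}" "u < n" "v < n"
      by (auto simp: strip_def)
    with e iff[of u v] show "e \<in> ?E" by auto
  qed
  then show ?thesis
    by (simp add: graph_power_def path_graph_def)
qed

text \<open>
  Double counting of the pairs of a spanning tree and one of its leaves.
\<close>

lemma total_leaves_eq_sum:
  assumes "finite V" and E: "\<forall>e\<in>E. e \<subseteq> V \<and> card e = 2"
  shows "total_leaves (Graph V E) =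
    (\<Sum>v\<in>V. card {e \<in> E. v \<in> e} * card (spanning_edge_sets (V - {v}) {e \<in> E. v \<notin> e}))"
proof -
  have sg: "simple_graph (Graph V E)"
    using assms by (simp add: simple_graph_def)
  have "finite E"
    using assms by (meson PowI finite_Pow_iff finite_subset subsetI)
  then have fin: "finite (spanning_edge_sets V E)"
    by (rule finite_spanning_edge_sets)
  let ?deg = "\<lambda>F v. card {e \<in> F. v \<in> e}"
  have "total_leaves (Graph V E) = (\<Sum>F\<in>spanning_edge_sets V E. card {v \<in> V. ?deg F v = 1})"
    unfolding total_leaves_def spanning_trees_eq[OF sg]
    by (subst sum.reindex) (auto simp: inj_on_def leaves_def vertex_degree_def)
  also have "\<dots> = (\<Sum>F\<in>spanning_edge_sets V E. \<Sum>v\<in>V. if ?deg F v = 1 then 1 else 0)"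
    using \<open>finite V\<close> by (simp add: sum.If_cases Int_def)
  also have "\<dots> = (\<Sum>v\<in>V. \<Sum>F\<in>spanning_edge_sets V E. if ?deg F v = 1 then 1 else 0)"
    by (rule sum.swap)
  also have "\<dots> = (\<Sum>v\<in>V. card {F \<in> spanning_edge_sets V E. ?deg F v = 1})"
    using fin by (simp add: sum.If_cases Int_def)
  also have "\<dots> = (\<Sum>v\<in>V. ?deg E v * card (spanning_edge_sets (V - {v}) {e \<in> E. v \<notin> e}))"
    using E by (intro sum.cong refl card_spanning_edge_sets_leaf) auto
  finally show ?thesis .
qed

lemma total_leaves_path_square:
  assumes "4 \<le> n"
  shows "total_leaves (graph_power (path_graph n) 2) =
    (\<Sum>v<n. (if v = 0 \<or> v = n - 1 then 2 else if v = 1 \<or> v = n - 2 then 3 else 4) *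
      (strip_trees v * strip_trees (n - 1 - v)))"
proof -
  have "total_leaves (graph_power (path_graph n) 2) = (\<Sum>v<n. card {e \<in> strip 0 n. v \<in> e} *
      card (spanning_edge_sets ({..<n} - {v}) {e \<in> strip 0 n. v \<notin> e}))"
    unfolding path_graph_square
    using strip_edge[of _ 0 n] by (intro total_leaves_eq_sum) (auto simp: atLeast0LessThan)
  then show ?thesis
    using assms card_edges_at_vertex_strip card_spanning_edge_sets_strip_delete by simp
qed

section \<open>The generating function\<close>

unbundle fps_syntax

definition strip_trees_fps :: "rat fps" where
  "strip_trees_fps = Abs_fps (\<lambda>n. of_nat (strip_trees n))"

lemma strip_trees_rec: "strip_trees (n + 4) + strip_trees (n + 2) = 3 * strip_trees (n + 3)"
  by (simp add: strip_trees_def numeral_eq_Suc)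

text \<open>
  The recurrence \<open>strip_trees_rec\<close> starts at index 4, because the values at 0 and 1 do not
  follow the Fibonacci pattern; hence the numerator has degree 3.
\<close>

lemma strip_trees_fps_eq:
  "strip_trees_fps * (1 - 3 * fps_X + fps_X ^ 2) = 1 - 2 * fps_X - fps_X ^ 2 + fps_X ^ 3"
proof (rule fps_ext)
  fix n
  have coeff: "(strip_trees_fps * (1 - 3 * fps_X + fps_X ^ 2)) $ n =
      strip_trees_fps $ n - 3 * (if n = 0 then 0 else strip_trees_fps $ (n - 1)) +
      (if n < 2 then 0 else strip_trees_fps $ (n - 2))"
    by (simp add: algebra_simps fps_X_power_mult_right_nth fps_numeral_fps_const)
  have small: "strip_trees 0 = 1" "strip_trees (Suc 0) = 1" "strip_trees 2 = 1" "strip_trees 3 = 3"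
    by (simp_all add: strip_trees_def numeral_eq_Suc)
  have "n = 0 \<or> n = 1 \<or> n = 2 \<or> n = 3 \<or> n = (n - 4) + 4"
    by arith
  then consider "n = 0" | "n = 1" | "n = 2" | "n = 3" | m where "n = m + 4"
    by blast
  then show "(strip_trees_fps * (1 - 3 * fps_X + fps_X ^ 2)) $ n =
      (1 - 2 * fps_X - fps_X ^ 2 + fps_X ^ 3) $ n"
  proof cases
    case 5
    have "of_nat (strip_trees (m + 4)) + of_nat (strip_trees (m + 2)) = (3 * of_nat (strip_trees (m + 3)) :: rat)"
      using strip_trees_rec[of m] by (metis of_nat_add of_nat_mult of_nat_numeral)
    moreover have "m + 4 - 1 = m + 3" "m + 4 - 2 = m + 2" by simp_all
    ultimately show ?thesis
      unfolding coeff
      by (simp add: 5 strip_trees_fps_def fps_numeral_fps_const fps_X_power_nth add.commute[of 3])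
  qed (unfold coeff, simp_all add: strip_trees_fps_def small fps_numeral_fps_const fps_X_power_nth)
qed

text \<open>
  The number of leaves is a convolution of \<open>strip_trees\<close> with itself, weighted by the vertex
  degrees. Writing the degree of a vertex as 4 minus corrections at the two vertices on either end leaves
  the square of the series and two linear terms.
\<close>

lemma total_leaves_eq_fps_nth:
  "of_nat (total_leaves (graph_power (path_graph (m + 4)) 2)) =
    (4 * strip_trees_fps ^ 2 - 4 * strip_trees_fps - 2 * fps_X * strip_trees_fps) $ (m + 3)"
proof -
  let ?t = "\<lambda>n. of_nat (strip_trees n) :: rat"
  let ?f = "\<lambda>v. ?t v * ?t (m + 3 - v)"
  let ?deg = "\<lambda>v. if v = 0 \<or> v = m + 3 then 2 else if v = 1 \<or> v = m + 2 then 3 else (4 :: nat)"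
  have "m + 4 - 1 = m + 3" "m + 4 - 2 = m + 2" "4 \<le> m + 4"
    by simp_all
  from total_leaves_path_square[OF this(3)]
  have "total_leaves (graph_power (path_graph (m + 4)) 2) =
      (\<Sum>v<m + 4. ?deg v * (strip_trees v * strip_trees (m + 3 - v)))"
    unfolding \<open>m + 4 - 1 = m + 3\<close> \<open>m + 4 - 2 = m + 2\<close> .
  then have "rat_of_nat (total_leaves (graph_power (path_graph (m + 4)) 2)) =
      (\<Sum>v<m + 4. of_nat (?deg v) * ?f v)"
    by (simp only: of_nat_sum of_nat_mult)
  also have "\<dots> = (\<Sum>v<m + 4. (4 - (if v = 0 then 2 else 0) - (if v = m + 3 then 2 else 0)
      - (if v = 1 then 1 else 0) - (if v = m + 2 then 1 else 0)) * ?f v)"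
    by (intro sum.cong refl arg_cong2[where f = "(*)"]) auto
  also have "\<dots> = 4 * (\<Sum>v<m + 4. ?f v) - 2 * ?f 0 - 2 * ?f (m + 3) - ?f 1 - ?f (m + 2)"
    by (simp add: left_diff_distrib sum_subtractf sum_distrib_left mult_delta_left)
  also have "\<dots> = 4 * (\<Sum>v<m + 4. ?f v) - 4 * ?t (m + 3) - 2 * ?t (m + 2)"
    by (simp add: strip_trees_def[of 0] strip_trees_def[of "Suc 0"])
  also have "(\<Sum>v<m + 4. ?f v) = (strip_trees_fps ^ 2) $ (m + 3)"
    by (simp add: power2_eq_square fps_mult_nth strip_trees_fps_def lessThan_Suc_atMost[symmetric]
        atLeast0AtMost numeral_eq_Suc)
  finally show ?thesis
    by (simp add: strip_trees_fps_def fps_numeral_fps_const mult.assoc)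
qed

theorem theorem6p2p1:
  shows "Abs_fps (\<lambda>m. of_nat (total_leaves (graph_power (path_graph (m + 4)) 2)))
    = - 2 * (2 * fps_X ^ 3 - 15 * fps_X ^ 2 + 27 * fps_X - 9)
        / ((fps_X ^ 2 - 3 * fps_X + 1) ^ 2 :: rat fps)"
proof -
  define A :: "rat fps" where
    "A = Abs_fps (\<lambda>m. of_nat (total_leaves (graph_power (path_graph (m + 4)) 2)))"
  define D :: "rat fps" where "D = fps_X ^ 2 - 3 * fps_X + 1"
  define T where "T = strip_trees_fps"
  define P :: "rat fps" where "P = 1 - 2 * fps_X - fps_X ^ 2 + fps_X ^ 3"
  have TD: "T * D = P"
    using strip_trees_fps_eq by (simp add: T_def D_def P_def algebra_simps)
  have small: "T $ 0 = 1" "T $ 1 = 1" "T $ 2 = 1"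
    by (simp_all add: T_def strip_trees_fps_def strip_trees_def)
  \<comment> \<open>The index shift by 3 comes from \<open>n - 1 = m + 3\<close>; \<open>2 * x + 6 * x^2\<close> are the terms below it.\<close>
  have shift: "4 * T ^ 2 - 4 * T - 2 * fps_X * T = fps_X ^ 3 * A + 2 * fps_X + 6 * fps_X ^ 2"
  proof (rule fps_ext)
    fix n :: nat
    have "n = 0 \<or> n = 1 \<or> n = 2 \<or> n = (n - 3) + 3"
      by arith
    then consider "n = 0" | "n = 1" | "n = 2" | m where "n = m + 3"
      by blast
    then show "(4 * T ^ 2 - 4 * T - 2 * fps_X * T) $ n = (fps_X ^ 3 * A + 2 * fps_X + 6 * fps_X ^ 2) $ n"
    proof cases
      case 4
      then show ?thesis
        using total_leaves_eq_fps_nth[of m]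
        by (simp add: T_def A_def fps_X_power_mult_nth fps_X_power_nth fps_numeral_fps_const)
    qed (use small in \<open>simp_all add: power2_eq_square fps_mult_nth numeral_2_eq_2
        fps_X_power_mult_nth fps_numeral_fps_const\<close>)
  qed
  \<comment> \<open>Multiplied by \<open>D^2\<close>, the series \<open>T\<close> enters only through \<open>T * D = P\<close>, a polynomial.\<close>
  have "fps_X ^ 3 * (A * D ^ 2) = (4 * T ^ 2 - 4 * T - 2 * fps_X * T - 2 * fps_X - 6 * fps_X ^ 2) * D ^ 2"
    unfolding shift by (simp add: algebra_simps)
  also have "\<dots> = 4 * (T * D) ^ 2 - (4 + 2 * fps_X) * (T * D) * D - (2 * fps_X + 6 * fps_X ^ 2) * D ^ 2"
    by (simp add: algebra_simps power2_eq_square)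
  also have "\<dots> = fps_X ^ 3 * (- 2 * (2 * fps_X ^ 3 - 15 * fps_X ^ 2 + 27 * fps_X - 9))"
    unfolding TD unfolding P_def D_def by algebra
  finally have AD: "A * D ^ 2 = - 2 * (2 * fps_X ^ 3 - 15 * fps_X ^ 2 + 27 * fps_X - 9)"
    by simp
  have "D $ 0 = 1"
    by (simp add: D_def power2_eq_square)
  then have "D ^ 2 \<noteq> 0"
    by auto
  then have "A = (A * D ^ 2) / D ^ 2"
    by simp
  then show ?thesis
    unfolding AD unfolding A_def D_def .
qed

end
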